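(* Let $M$ be an infinite complete pointed metric space. Then $\operatorname{SNA}(M)$ contains an isomorphic copy of $c_0$; that is, there is a linear operator $T\colon c_0\to \mathrm{Lip}_0(M)$ which is an isomorphism onto its image $T(c_0)$ and such that $T(c_0)\subseteq \operatorname{SNA}(M)$.
   Context: A pointed metric space is a metric space $(M,d)$ with a distinguished point $0\in M$. $\mathrm{Lip}_0(M)$ denotes the Banach space of all real-valued Lipschitz functions $f$ on $M$ with $f(0)=0$, with norm $\|f\|=\sup\{|f(x)-f(y)|/d(x,y): x,y\in M,\ x\neq y\}$. A function $f\in \mathrm{Lip}_0(M)$ strongly attains its norm if there are distinct points $x,y\in M$ with $\frac{f(x)-f(y)}{d(x,y)}=\|f\|$; $\operatorname{SNA}(M)$ is the set of all $f\in\mathrm{Lip}_0(M)$ that strongly attain their norm. $c_0$ is the real Banach space of sequences converging to $0$ with the supremum norm. "Isomorphism onto its image" means a linear bijection onto the image that is bounded with bounded inverse. *)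

theory Defs
  imports "HOL-Analysis.Analysis"
begin

text \<open>
  A metric space is a type of class \<open>metric_space\<close>; the distinguished point is a parameter.
  The spaces \<open>c\<^sub>0\<close> and \<open>Lip\<^sub>0(M)\<close> are sets of real-valued functions with the pointwise
  vector space operations.
\<close>

definition c0 :: "(nat \<Rightarrow> real) set" where
  "c0 = {x. x \<longlonglongrightarrow> 0}"

definition c0_norm :: "(nat \<Rightarrow> real) \<Rightarrow> real" where
  "c0_norm x = (SUP n. \<bar>x n\<bar>)"

definition Lip0 :: "'a::metric_space \<Rightarrow> ('a \<Rightarrow> real) set" where
  "Lip0 p = {f. (\<exists>C. C-lipschitz_on UNIV f) \<and> f p = 0}"

text \<open>
  The supremum is taken in \<open>real\<close>, so this is meaningful only for Lipschitz \<open>f\<close> on a space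
  with at least two points.
\<close>

definition Lip_norm :: "('a::metric_space \<Rightarrow> real) \<Rightarrow> real" where
  "Lip_norm f = Sup {\<bar>f x - f y\<bar> / dist x y | x y. x \<noteq> y}"

definition SNA :: "'a::metric_space \<Rightarrow> ('a \<Rightarrow> real) set" where
  "SNA p = {f \<in> Lip0 p. \<exists>x y. x \<noteq> y \<and> (f x - f y) / dist x y = Lip_norm f}"

definition linear_operator ::
  "('s \<Rightarrow> real) set \<Rightarrow> ('t \<Rightarrow> real) set \<Rightarrow> (('s \<Rightarrow> real) \<Rightarrow> ('t \<Rightarrow> real)) \<Rightarrow> bool" where
  "linear_operator V W T \<longleftrightarrow>
     T \<in> V \<rightarrow> W \<and>
     (\<forall>x\<in>V. \<forall>y\<in>V. T (\<lambda>s. x s + y s) = (\<lambda>t. T x t + T y t)) \<and>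
     (\<forall>a. \<forall>x\<in>V. T (\<lambda>s. a * x s) = (\<lambda>t. a * T x t))"

definition bounded_operator ::
  "'v set \<Rightarrow> ('v \<Rightarrow> real) \<Rightarrow> ('w \<Rightarrow> real) \<Rightarrow> ('v \<Rightarrow> 'w) \<Rightarrow> bool" where
  "bounded_operator V normV normW T \<longleftrightarrow> (\<exists>C. \<forall>x\<in>V. normW (T x) \<le> C * normV x)"

definition isomorphism_onto_image ::
  "'v set \<Rightarrow> ('v \<Rightarrow> real) \<Rightarrow> ('w \<Rightarrow> real) \<Rightarrow> ('v \<Rightarrow> 'w) \<Rightarrow> bool" where
  "isomorphism_onto_image V normV normW T \<longleftrightarrow>
     bij_betw T V (T ` V) \<and>
     bounded_operator V normV normW T \<and>
     bounded_operator (T ` V) normW normV (inv_into V T)"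

end

theory Submission imports Defs begin

text \<open>
  Let \<open>r u\<close> be the distance from \<open>u\<close> to the other points.  Take 1-Lipschitz functions \<open>f\<^sub>n\<close> with
  disjoint supports, each attaining slope 1, such that for \<open>m \<noteq> n\<close> only finitely many pairs
  violate \<open>\<bar>f\<^sub>m u\<bar> + \<bar>f\<^sub>n v\<bar> \<le> d(u,v)\<close>.  For \<open>a \<in> c\<^sub>0\<close> the slope of \<open>\<Sum> a\<^sub>n f\<^sub>n\<close> between the supports of \<open>f\<^sub>m\<close> and
  \<open>f\<^sub>n\<close> is at most \<open>\<bar>a\<^sub>m\<bar> + \<bar>a\<^sub>n\<bar>\<close>, and at most \<open>max \<bar>a\<^sub>n\<bar>\<close> off the violating pairs; as \<open>a\<^sub>n \<rightarrow> 0\<close>,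
  for each \<open>B > max \<bar>a\<^sub>n\<bar>\<close> only finitely many slopes exceed \<open>B\<close>, so the supremum is attained.

  Such functions always exist.  If there are infinitely many disjoint pairs with
  \<open>d(u,v) \<le> r u + r v\<close>, use functions supported on these pairs.  Otherwise, off a finite set,
  \<open>d(u,v) > r u + r v\<close> and \<open>r u\<close> is not attained (two points with a common nearest point would form
  such a pair).  Points \<open>v\<close> with \<open>d(u,v)\<close> close to \<open>r u\<close> then have small \<open>r v\<close>, so there are distinct
  points \<open>w\<^sub>k\<close> with \<open>r w\<^sub>k \<rightarrow> 0\<close>.  By completeness they either contain a separated sequence or
  accumulate somewhere; in both cases a subsequence carries disjoint balls of radius \<open>t\<^sub>k > r w\<^sub>k\<close>, and
  \<open>f\<^sub>k = max 0 (t\<^sub>k - d(w\<^sub>k, -))\<close> works.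
\<close>

section \<open>Choice of sequences, \<open>c0\<close>, and norm attainment\<close>

text \<open>Each term is chosen against the finite set of its predecessors; the index in
  \<open>Q\<close> lets the requirement tighten along the sequence.\<close>

lemma finite_extension_sequence:
  assumes "\<And>n F. finite F \<Longrightarrow> F \<subseteq> V \<Longrightarrow> \<exists>y\<in>V. Q n y \<and> (\<forall>x\<in>F. R x y)"
  shows "\<exists>e :: nat \<Rightarrow> 'b. (\<forall>n. e n \<in> V \<and> Q n (e n)) \<and> (\<forall>m n. m < n \<longrightarrow> R (e m) (e n))"
proof -
  have "\<exists>e. \<forall>n. e n \<in> V \<and> Q n (e n) \<and> (\<forall>m<n. R (e m) (e n))"
  proof (rule dependent_wellorder_choice)
    fix n :: nat and e :: "nat \<Rightarrow> 'b"
    assume "\<And>m. m < n \<Longrightarrow> e m \<in> V \<and> Q m (e m) \<and> (\<forall>k<m. R (e k) (e m))"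
    then show "\<exists>y. y \<in> V \<and> Q n y \<and> (\<forall>m<n. R (e m) y)"
      using assms[of "e ` {..<n}" n] by fastforce
  qed auto
  then show ?thesis by blast
qed

text \<open>A nonzero term dominates the tail, so the supremum is a maximum over finitely many
  indices.\<close>

lemma c0_sup_attained:
  assumes "a \<in> c0"
  obtains n where "c0_norm a = \<bar>a n\<bar>" "\<And>m. \<bar>a m\<bar> \<le> \<bar>a n\<bar>"
proof -
  have "\<exists>n. \<forall>m. \<bar>a m\<bar> \<le> \<bar>a n\<bar>"
  proof (cases "\<exists>k. a k \<noteq> 0")
    case True
    then obtain k where k: "a k \<noteq> 0" by blast
    have "(\<lambda>n. \<bar>a n\<bar>) \<longlonglongrightarrow> 0"
      using assms by (simp add: c0_def tendsto_rabs_zero)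
    then have "\<forall>\<^sub>F n in sequentially. \<bar>a n\<bar> < \<bar>a k\<bar>"
      using k by (intro order_tendstoD(2)) auto
    then obtain N where N: "\<And>n. n \<ge> N \<Longrightarrow> \<bar>a n\<bar> < \<bar>a k\<bar>"
      by (auto simp: eventually_sequentially)
    obtain n where n: "n \<in> {..max N k}" "\<bar>a n\<bar> = Max ((\<lambda>m. \<bar>a m\<bar>) ` {..max N k})"
      using Max_in[of "(\<lambda>m. \<bar>a m\<bar>) ` {..max N k}"] by fastforce
    have le: "\<bar>a m\<bar> \<le> \<bar>a n\<bar>" if "m \<le> max N k" for m
      using that unfolding n(2) by (intro Max_ge) auto
    have "\<bar>a m\<bar> \<le> \<bar>a n\<bar>" for m
      using le[of m] le[of k] N[of m] by (cases "m \<le> max N k") fastforce+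
    then show ?thesis by blast
  qed auto
  then obtain n where n: "\<And>m. \<bar>a m\<bar> \<le> \<bar>a n\<bar>" by blast
  moreover have "c0_norm a = \<bar>a n\<bar>"
    unfolding c0_norm_def by (rule cSup_eq_maximum) (use n in auto)
  ultimately show ?thesis using that by blast
qed

lemma finite_c0_gt:
  assumes "a \<in> c0" "e > 0"
  shows "finite {n. \<bar>a n\<bar> > e}"
proof -
  have "(\<lambda>n. \<bar>a n\<bar>) \<longlonglongrightarrow> 0"
    using assms by (simp add: c0_def tendsto_rabs_zero)
  then have "\<forall>\<^sub>F n in sequentially. \<bar>a n\<bar> < e"
    using assms by (intro order_tendstoD(2)) auto
  then obtain N where "\<And>n. n \<ge> N \<Longrightarrow> \<bar>a n\<bar> < e"
    by (auto simp: eventually_sequentially)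
  then have "{n. \<bar>a n\<bar> > e} \<subseteq> {..<N}"
    by (smt (verit) lessThan_iff mem_Collect_eq not_le subsetI)
  then show ?thesis using finite_subset by blast
qed

text \<open>Division by zero yields 0, so equal points satisfy the bound; swapping \<open>u\<close>
  and \<open>v\<close> if necessary removes the absolute value.\<close>

lemma SNA_if_slopes_bounded:
  assumes "f p = 0" and "u \<noteq> v" and "\<And>x y. \<bar>f x - f y\<bar> / dist x y \<le> \<bar>f u - f v\<bar> / dist u v"
  shows "f \<in> SNA p" "Lip_norm f = \<bar>f u - f v\<bar> / dist u v"
proof -
  let ?s = "\<bar>f u - f v\<bar> / dist u v"
  show norm: "Lip_norm f = ?s"
    unfolding Lip_norm_def by (rule cSup_eq_maximum) (use assms in auto)
  have "\<bar>f x - f y\<bar> \<le> ?s * dist x y" for x y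
    using assms(3)[of x y] by (cases "x = y") (auto simp: field_simps)
  then have "?s-lipschitz_on UNIV f"
    by (intro lipschitz_onI) (auto simp: dist_real_def)
  then have "f \<in> Lip0 p"
    using assms(1) unfolding Lip0_def by blast
  moreover have "\<exists>x y. x \<noteq> y \<and> (f x - f y) / dist x y = Lip_norm f"
  proof (cases "f u \<ge> f v")
    case True
    then show ?thesis using norm assms(2) by (intro exI[of _ u] exI[of _ v]) auto
  next
    case False
    then show ?thesis using norm assms(2)
      by (intro exI[of _ v] exI[of _ u]) (auto simp: dist_commute)
  qed
  ultimately show "f \<in> SNA p" unfolding SNA_def by blast
qed

section \<open>Superpositions of disjointly supported functions\<close>

text \<open>\<open>vanish\<close> does not follow from \<open>disjoint\<close>, since
  \<open>f n\<close> may be zero at one of \<open>x n\<close>, \<open>y n\<close>.\<close>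

locale bump_family =
  fixes f :: "nat \<Rightarrow> 'a::metric_space \<Rightarrow> real" and x y :: "nat \<Rightarrow> 'a"
  assumes lipschitz: "\<And>n u v. \<bar>f n u - f n v\<bar> \<le> dist u v"
    and disjoint: "\<And>m n u. f m u \<noteq> 0 \<Longrightarrow> f n u \<noteq> 0 \<Longrightarrow> m = n"
    and distinct: "\<And>n. x n \<noteq> y n"
    and attained: "\<And>n. f n (x n) - f n (y n) = dist (x n) (y n)"
    and vanish: "\<And>m n. m \<noteq> n \<Longrightarrow> f m (x n) = 0" "\<And>m n. m \<noteq> n \<Longrightarrow> f m (y n) = 0"
    and finite_steep: "\<And>m n. m \<noteq> n \<Longrightarrow>
      finite {(u, v). f m u \<noteq> 0 \<and> f n v \<noteq> 0 \<and> \<bar>f m u\<bar> + \<bar>f n v\<bar> > dist u v}"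
begin

text \<open>Off all supports \<open>idx u\<close> is an arbitrary number, but there every \<open>f n u\<close> vanishes.\<close>

definition idx :: "'a \<Rightarrow> nat" where
  "idx u = (SOME n. f n u \<noteq> 0)"

definition superpose :: "(nat \<Rightarrow> real) \<Rightarrow> 'a \<Rightarrow> real" where
  "superpose a u = a (idx u) * f (idx u) u"

lemma idx_eq: "f n u \<noteq> 0 \<Longrightarrow> idx u = n"
  unfolding idx_def by (rule some_equality) (use disjoint in auto)

lemma superpose_eq:
  assumes "\<And>m. m \<noteq> n \<Longrightarrow> f m u = 0"
  shows "superpose a u = a n * f n u"
  unfolding superpose_def by (cases "idx u = n") (use assms idx_eq in force)+

text \<open>Recovers each coefficient, which yields injectivity and the lower norm bound.\<close>

lemma superpose_peak: "superpose a (x n) - superpose a (y n) = a n * dist (x n) (y n)"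
  using superpose_eq[of n "x n" a] superpose_eq[of n "y n" a] vanish attained[of n]
  by (metis right_diff_distrib)

text \<open>The two bounds bear on the sets of large slopes: the first confines slopes above \<open>A\<close> to the
  pairs in \<open>finite_steep\<close>, the second leaves only finitely many of the indices \<open>m\<close>, \<open>n\<close> there.\<close>

lemma superpose_slope:
  assumes "\<And>n. \<bar>a n\<bar> \<le> A"
  shows "\<bar>superpose a u - superpose a v\<bar> \<le> A * dist u v \<or>
    idx u \<noteq> idx v \<and> f (idx u) u \<noteq> 0 \<and> f (idx v) v \<noteq> 0 \<and>
    \<bar>f (idx u) u\<bar> + \<bar>f (idx v) v\<bar> > dist u v"
    (is "?flat \<or> _")
    and "\<bar>superpose a u - superpose a v\<bar> \<le> (\<bar>a (idx u)\<bar> + \<bar>a (idx v)\<bar>) * dist u v"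
proof -
  let ?m = "idx u" and ?n = "idx v"
  have A: "A \<ge> 0" using assms[of 0] by linarith
  have same: "\<bar>superpose a u - superpose a v\<bar> \<le> \<bar>a ?m\<bar> * dist u v" if "?m = ?n"
    using lipschitz[of ?m u v] that unfolding superpose_def
    by (simp add: abs_mult mult_left_mono flip: right_diff_distrib)
  have tri: "\<bar>superpose a u - superpose a v\<bar> \<le> \<bar>a ?m\<bar> * \<bar>f ?m u\<bar> + \<bar>a ?n\<bar> * \<bar>f ?n v\<bar>"
    unfolding superpose_def by (metis abs_mult abs_triangle_ineq4)
  \<comment> \<open>Each function vanishes at the other point, so its Lipschitz bound controls its
    value.\<close>
  have bd: "\<bar>f ?m u\<bar> \<le> dist u v" "\<bar>f ?n v\<bar> \<le> dist u v" if "?m \<noteq> ?n"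
  proof -
    have "f ?m v = 0" "f ?n u = 0" using idx_eq[of ?m v] idx_eq[of ?n u] that by auto
    then show "\<bar>f ?m u\<bar> \<le> dist u v" "\<bar>f ?n v\<bar> \<le> dist u v"
      using lipschitz[of ?m u v] lipschitz[of ?n u v] by auto
  qed
  show "\<bar>superpose a u - superpose a v\<bar> \<le> (\<bar>a ?m\<bar> + \<bar>a ?n\<bar>) * dist u v"
  proof (cases "?m = ?n")
    case True
    have "0 \<le> \<bar>a ?n\<bar> * dist u v" by simp
    with same[OF True] show ?thesis unfolding distrib_right by linarith
  next
    case False
    with tri bd[OF False] show ?thesis
      by (smt (verit) distrib_right mult_left_mono abs_ge_zero)
  qed
  show "?flat \<or> ?m \<noteq> ?n \<and> f ?m u \<noteq> 0 \<and> f ?n v \<noteq> 0 \<and> \<bar>f ?m u\<bar> + \<bar>f ?n v\<bar> > dist u v"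
  proof (cases "?m = ?n")
    case True
    have "\<bar>a ?m\<bar> * dist u v \<le> A * dist u v" by (simp add: assms mult_right_mono)
    with same[OF True] show ?thesis by linarith
  next
    case False
    have "\<bar>superpose a u - superpose a v\<bar> \<le> A * (\<bar>f ?m u\<bar> + \<bar>f ?n v\<bar>)"
      using tri mult_right_mono[OF assms[of ?m], of "\<bar>f ?m u\<bar>"]
        mult_right_mono[OF assms[of ?n], of "\<bar>f ?n v\<bar>"] by (simp add: distrib_left)
    moreover have "A * (\<bar>f ?m u\<bar> + \<bar>f ?n v\<bar>) \<le> A * dist u v"
      if "\<bar>f ?m u\<bar> + \<bar>f ?n v\<bar> \<le> dist u v"
      using that A by (simp add: mult_left_mono)
    \<comment> \<open>If one value is 0, \<open>bd\<close> bounds the other by the distance and the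
      first alternative holds.\<close>
    ultimately show ?thesis using False bd[OF False] by (cases "f ?m u = 0 \<or> f ?n v = 0") force+
  qed
qed

lemma superpose_max_slope:
  assumes a: "a \<in> c0"
  obtains u v where "u \<noteq> v"
    "\<And>z w. \<bar>superpose a z - superpose a w\<bar> / dist z w \<le> \<bar>superpose a u - superpose a v\<bar> / dist u v"
    "c0_norm a \<le> \<bar>superpose a u - superpose a v\<bar> / dist u v"
    "\<bar>superpose a u - superpose a v\<bar> / dist u v \<le> 2 * c0_norm a"
proof -
  define s where "s = (\<lambda>(u, v). \<bar>superpose a u - superpose a v\<bar> / dist u v)"
  obtain n0 where n0: "c0_norm a = \<bar>a n0\<bar>" "\<And>m. \<bar>a m\<bar> \<le> \<bar>a n0\<bar>"
    using c0_sup_attained[OF a] by blast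
  define A where "A = c0_norm a"
  have A: "\<bar>a m\<bar> \<le> A" "A \<ge> 0" for m using n0 A_def by auto
  have peak: "s (x n0, y n0) = A"
    using superpose_peak[of a n0] distinct[of n0] n0 unfolding s_def A_def
    by (simp add: abs_mult)
  have s_le: "s (u, v) \<le> \<bar>a (idx u)\<bar> + \<bar>a (idx v)\<bar>" for u v
    using superpose_slope(2)[of a A u v, OF A(1)] unfolding s_def
    by (cases "u = v") (auto simp: divide_simps)
  have upper: "s (u, v) \<le> 2 * A" for u v
    using s_le[of u v] A(1)[of "idx u"] A(1)[of "idx v"] by linarith
  have "\<exists>q. fst q \<noteq> snd q \<and> A \<le> s q \<and> (\<forall>q'. s q' \<le> s q)"
  proof (cases "\<forall>q. s q \<le> A")
    case True
    then show ?thesis using peak distinct[of n0] by (intro exI[of _ "(x n0, y n0)"]) auto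
  next
    case False
    then obtain q0 where q0: "s q0 > A" by (meson not_le)
    \<comment> \<open>Half the excess: \<open>q0\<close> stays in \<open>Z\<close>, and a slope
      above \<open>A + e\<close> forces both coefficients above \<open>e\<close>, as neither exceeds
      \<open>A\<close>.\<close>
    define e where "e = (s q0 - A) / 2"
    define K where "K = {n. \<bar>a n\<bar> > e}"
    define Z where "Z = {q. s q > A + e}"
    have e: "e > 0" "q0 \<in> Z" using q0 unfolding e_def Z_def by (auto simp: field_simps)
    have "Z \<subseteq> (\<Union>m\<in>K. \<Union>n\<in>K-{m}.
        {(u, v). f m u \<noteq> 0 \<and> f n v \<noteq> 0 \<and> \<bar>f m u\<bar> + \<bar>f n v\<bar> > dist u v})"
    proof
      fix q assume q: "q \<in> Z"
      obtain u v where uv: "q = (u, v)" by force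
      have big: "s (u, v) > A + e" using q uv unfolding Z_def by auto
      then have K: "idx u \<in> K" "idx v \<in> K"
        using s_le[of u v] A(1)[of "idx u"] A(1)[of "idx v"] unfolding K_def by auto
      have "\<not> \<bar>superpose a u - superpose a v\<bar> \<le> A * dist u v"
      proof
        assume "\<bar>superpose a u - superpose a v\<bar> \<le> A * dist u v"
        then have "s (u, v) \<le> A"
          using A(2) unfolding s_def by (cases "u = v") (auto simp: field_simps)
        with big e(1) show False by linarith
      qed
      then show "q \<in> (\<Union>m\<in>K. \<Union>n\<in>K-{m}.
        {(u, v). f m u \<noteq> 0 \<and> f n v \<noteq> 0 \<and> \<bar>f m u\<bar> + \<bar>f n v\<bar> > dist u v})"
        using superpose_slope(1)[of a A u v, OF A(1)] uv K
        by (intro UN_I[of "idx u"] UN_I[of "idx v"]) auto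
    qed
    moreover have "finite K" unfolding K_def using finite_c0_gt[OF a e(1)] .
    ultimately have Z: "finite Z"
      by (rule finite_subset[OF _ finite_UN_I]) (use finite_steep \<open>finite K\<close> in auto)
    obtain q where q: "q \<in> Z" "s q = Max (s ` Z)"
      using Max_in[of "s ` Z"] Z e(2) by fastforce
    have "s q' \<le> s q" for q'
    proof (cases "q' \<in> Z")
      case True
      then show ?thesis using q Z by simp
    next
      case False
      then show ?thesis using q(1) unfolding Z_def by auto
    qed
    moreover have "A \<le> s q" using q(1) e unfolding Z_def by auto
    \<comment> \<open>Equal points have slope 0 by the division convention, hence lie outside
      \<open>Z\<close>.\<close>
    moreover have "fst q \<noteq> snd q"
      using q(1) e A(2) unfolding Z_def s_def by (auto split: prod.splits)
    ultimately show ?thesis by blast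
  qed
  then obtain u v where "u \<noteq> v" "A \<le> s (u, v)" "\<And>q. s q \<le> s (u, v)" by auto
  then show ?thesis using that[of u v] upper[of u v] unfolding A_def s_def by auto
qed

lemma c0_embeds_in_SNA:
  fixes p :: 'a
  shows "\<exists>T. linear_operator c0 (Lip0 p) T \<and>
       isomorphism_onto_image c0 c0_norm Lip_norm T \<and> T ` c0 \<subseteq> SNA p"
proof -
  \<comment> \<open>Subtracting a constant makes the value at \<open>p\<close> zero and changes no
    slope.\<close>
  define T :: "(nat \<Rightarrow> real) \<Rightarrow> 'a \<Rightarrow> real"
    where "T a u = superpose a u - superpose a p" for a u
  have main: "T a \<in> SNA p \<and> c0_norm a \<le> Lip_norm (T a) \<and> Lip_norm (T a) \<le> 2 * c0_norm a"
    if a: "a \<in> c0" for a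
  proof -
    have diff: "superpose a z - superpose a w = T a z - T a w" for z w
      by (simp add: T_def)
    obtain u v where uv: "u \<noteq> v"
      "\<And>z w. \<bar>T a z - T a w\<bar> / dist z w \<le> \<bar>T a u - T a v\<bar> / dist u v"
      "c0_norm a \<le> \<bar>T a u - T a v\<bar> / dist u v"
      "\<bar>T a u - T a v\<bar> / dist u v \<le> 2 * c0_norm a"
      using superpose_max_slope[OF a] unfolding diff by blast
    have "T a p = 0" by (simp add: T_def)
    from SNA_if_slopes_bounded[OF this uv(1,2)] uv(3,4) show ?thesis by simp
  qed
  have inj: "inj_on T c0"
  proof
    fix a b assume "T a = T b"
    then have "T a (x n) - T a (y n) = T b (x n) - T b (y n)" for n by simp
    then have "a n = b n" for n
      using superpose_peak[of a n] superpose_peak[of b n] distinct[of n] unfolding T_def by simp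
    then show "a = b" by auto
  qed
  have "linear_operator c0 (Lip0 p) T"
    using main unfolding linear_operator_def SNA_def
    by (auto simp: T_def superpose_def algebra_simps fun_eq_iff)
  moreover have "isomorphism_onto_image c0 c0_norm Lip_norm T"
    unfolding isomorphism_onto_image_def bounded_operator_def
  proof (intro conjI)
    show "bij_betw T c0 (T ` c0)" using inj by (simp add: inj_on_imp_bij_betw)
    show "\<exists>C. \<forall>a\<in>c0. Lip_norm (T a) \<le> C * c0_norm a" using main by blast
    show "\<exists>C. \<forall>g\<in>T ` c0. c0_norm (inv_into c0 T g) \<le> C * Lip_norm g"
      using main inj by (intro exI[of _ 1]) auto
  qed
  ultimately show ?thesis using main by blast
qed

end

section \<open>Distance from a point to the rest of the space\<close>

definition isol :: "'a::metric_space \<Rightarrow> real" where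
  "isol u = infdist u (- {u})"

lemma isol_nonneg: "isol u \<ge> 0"
  unfolding isol_def by (rule infdist_nonneg)

lemma isol_le: "u \<noteq> v \<Longrightarrow> isol u \<le> dist u v"
  unfolding isol_def by (rule infdist_le) auto

lemma isol_almost_attained:
  assumes "infinite (UNIV :: 'a::metric_space set)" "isol (u::'a) < t"
  obtains v where "v \<noteq> u" "dist u v < t"
proof -
  have "- {u} \<noteq> {}" using assms(1) by (metis Compl_empty_eq double_complement finite.emptyI finite_insert)
  then show ?thesis using that assms(2) unfolding isol_def infdist_def
    by (auto simp: cINF_less_iff)
qed

text \<open>A finite set would contain a point nearest to \<open>u\<close>; as the infimum is not
  attained, some point is nearer still.\<close>

lemma infinite_near_if_isol_not_attained:
  assumes inf: "infinite (UNIV :: 'a::metric_space set)"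
    and not_attained: "\<And>v. v \<noteq> u \<Longrightarrow> dist u v \<noteq> isol (u::'a)" and "e > 0"
  shows "infinite {v. v \<noteq> u \<and> dist u v < isol u + e}" (is "infinite ?Q")
proof
  assume fin: "finite ?Q"
  obtain v0 where "v0 \<noteq> u" "dist u v0 < isol u + e"
    using isol_almost_attained[OF inf, of u "isol u + e"] \<open>e > 0\<close> by auto
  then have ne: "?Q \<noteq> {}" by blast
  obtain v where v: "v \<in> ?Q" "dist u v = Min (dist u ` ?Q)"
    using Min_in[of "dist u ` ?Q"] fin ne by fastforce
  have "isol u < dist u v"
    using isol_le[of u v] not_attained[of v] v(1) by fastforce
  then obtain w where w: "w \<noteq> u" "dist u w < dist u v"
    using isol_almost_attained[OF inf] by blast
  then have "w \<in> ?Q" using v(1) by auto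
  then have "dist u v \<le> dist u w" using v(2) fin by simp
  with w show False by simp
qed

section \<open>Two constructions of bump families\<close>

text \<open>By \<open>edge\<close> the distance of a pair splits into two values, each at most
  \<open>isol\<close> of its point. Supports are finite, so \<open>finite_steep\<close> is
  immediate.\<close>

lemma bump_family_pairs:
  fixes u v :: "nat \<Rightarrow> 'a::metric_space"
  assumes ne: "\<And>n. u n \<noteq> v n" and edge: "\<And>n. dist (u n) (v n) \<le> isol (u n) + isol (v n)"
    and disj: "\<And>m n. m \<noteq> n \<Longrightarrow> {u m, v m} \<inter> {u n, v n} = {}"
  shows "\<exists>f. bump_family f u v"
proof -
  \<comment> \<open>Bounding the two values by \<open>isol\<close> makes the function 1-Lipschitz against all other points.\<close>
  define \<alpha> where "\<alpha> n = min (isol (u n)) (dist (u n) (v n))" for n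
  define \<beta> where "\<beta> n = dist (u n) (v n) - \<alpha> n" for n
  define f where "f n z = (if z = u n then \<alpha> n else if z = v n then - \<beta> n else 0)" for n z
  have ab: "0 \<le> \<alpha> n" "\<alpha> n \<le> isol (u n)" "0 \<le> \<beta> n" "\<beta> n \<le> isol (v n)"
    "\<alpha> n + \<beta> n = dist (u n) (v n)" for n
    using edge[of n] isol_nonneg[of "u n"] isol_nonneg[of "v n"] unfolding \<alpha>_def \<beta>_def
    by (auto simp: min_def)
  have lip: "\<bar>f n z - f n w\<bar> \<le> dist z w" for n z w
  proof (cases "z = w")
    case False
    then show ?thesis
      using ab[of n] isol_le[of z w] isol_le[of w z] unfolding f_def
      by (auto simp: dist_commute)
  qed simp
  have supp: "z \<in> {u n, v n}" if "f n z \<noteq> 0" for n z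
    using that unfolding f_def by (auto split: if_splits)
  have fin: "finite {(z, w). f m z \<noteq> 0 \<and> f n w \<noteq> 0 \<and> \<bar>f m z\<bar> + \<bar>f n w\<bar> > dist z w}" for m n
    by (rule finite_subset[of _ "{u m, v m} \<times> {u n, v n}"]) (use supp in auto)
  have "bump_family f u v"
  proof
    show "f n (u n) - f n (v n) = dist (u n) (v n)" for n
      using ne[of n] ab[of n] unfolding f_def by auto
    show "m = n" if "f m z \<noteq> 0" "f n z \<noteq> 0" for m n z
      using supp[OF that(1)] supp[OF that(2)] disj[of m n] by blast
    show "f m (u n) = 0" "f m (v n) = 0" if "m \<noteq> n" for m n
      using supp[of m "u n"] supp[of m "v n"] disj[OF that] by blast+
  qed (use lip ne fin in auto)
  then show ?thesis by blast
qed

text \<open>Slope 1 is attained between the centre and any other point of its ball, which exists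
  since the radius exceeds \<open>isol\<close>. Separated centres leave no steep pairs.\<close>

lemma bump_family_balls:
  fixes x :: "nat \<Rightarrow> 'a::metric_space"
  assumes inf: "infinite (UNIV :: 'a set)" and t: "\<And>n. isol (x n) < t n"
    and sep: "\<And>m n. m < n \<Longrightarrow> t m + t n \<le> dist (x m) (x n)"
  shows "\<exists>f y. bump_family f x y"
proof -
  have "\<forall>n. \<exists>v. v \<noteq> x n \<and> dist (x n) v < t n"
    using isol_almost_attained[OF inf t] by metis
  then obtain y where y: "\<And>n. y n \<noteq> x n" "\<And>n. dist (x n) (y n) < t n" by metis
  have sep': "t m + t n \<le> dist (x m) (x n)" if "m \<noteq> n" for m n
    using sep[of m n] sep[of n m] that by (cases "m < n") (auto simp: dist_commute)
  define f where "f n z = max 0 (t n - dist (x n) z)" for n z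
  have lip: "\<bar>f n z - f n w\<bar> \<le> dist z w" for n z w
    using dist_triangle[of "x n" z w] dist_triangle[of "x n" w z] unfolding f_def
    by (auto simp: dist_commute max_def)
  have tpos: "t n > 0" for n using t[of n] isol_nonneg[of "x n"] by linarith
  have gap: "\<bar>f m z\<bar> + \<bar>f n w\<bar> \<le> dist z w" if "f m z \<noteq> 0" "f n w \<noteq> 0" "m \<noteq> n" for m n z w
  proof -
    have "dist (x m) (x n) \<le> dist (x m) z + dist z w + dist (x n) w"
      using dist_triangle[of "x m" "x n" z] dist_triangle[of z "x n" w]
      by (simp add: dist_commute)
    then show ?thesis using that sep'[of m n] unfolding f_def by (auto simp: max_def)
  qed
  have nz: "f n (x n) \<noteq> 0" "f n (y n) \<noteq> 0" for n
    using tpos[of n] y(2)[of n] unfolding f_def by auto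
  \<comment> \<open>The case of equal points in \<open>gap\<close>: two nonzero values would sum to
    at most 0.\<close>
  have disj: "m = n" if "f m z \<noteq> 0" "f n z \<noteq> 0" for m n z
    using gap[OF that] that by fastforce
  have "bump_family f x y"
  proof
    show "f n (x n) - f n (y n) = dist (x n) (y n)" for n
      using y(2)[of n] tpos[of n] unfolding f_def by simp
    show "f m (x n) = 0" "f m (y n) = 0" if "m \<noteq> n" for m n
      using disj[of m "x n" n] disj[of m "y n" n] nz[of n] that by blast+
    show "finite {(z, w). f m z \<noteq> 0 \<and> f n w \<noteq> 0 \<and> \<bar>f m z\<bar> + \<bar>f n w\<bar> > dist z w}"
      if "m \<noteq> n" for m n
    proof -
      have "{(z, w). f m z \<noteq> 0 \<and> f n w \<noteq> 0 \<and> \<bar>f m z\<bar> + \<bar>f n w\<bar> > dist z w} = {}"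
        using gap[OF _ _ that] by force
      then show ?thesis by (rule ssubst) simp
    qed
    show "x n \<noteq> y n" for n using y(1)[of n] by simp
  qed (use lip disj in auto)
  then show ?thesis by blast
qed

section \<open>Existence of bump families in infinite complete spaces\<close>

text \<open>Without limit points \<open>W\<close> is closed, hence complete, but not compact, so
  total boundedness fails.\<close>

lemma separated_or_limit_point:
  fixes W :: "'a::complete_space set"
  assumes "infinite W"
  shows "(\<exists>e>0. \<forall>F. finite F \<longrightarrow> \<not> W \<subseteq> (\<Union>c\<in>F. ball c e)) \<or> (\<exists>z. z islimpt W)"
proof (rule disjCI)
  assume no_limit: "\<nexists>z. z islimpt W"
  then have cl: "closed W" using closed_limpt by blast
  have "\<not> compact W"
    using no_limit assms Heine_Borel_imp_Bolzano_Weierstrass[of W W] by blast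
  then show "\<exists>e>0. \<forall>F. finite F \<longrightarrow> \<not> W \<subseteq> (\<Union>c\<in>F. ball c e)"
    using cl by (auto simp: compact_eq_totally_bounded complete_eq_closed)
qed

lemma bump_family_exists:
  assumes inf: "infinite (UNIV :: 'a::complete_space set)"
  shows "\<exists>f (x :: nat \<Rightarrow> 'a) y. bump_family f x y"
proof (cases "\<forall>F. finite F \<longrightarrow> (\<exists>u v::'a. u \<notin> F \<and> v \<notin> F \<and> u \<noteq> v \<and> dist u v \<le> isol u + isol v)")
  case True
  let ?V = "{(u::'a, v). u \<noteq> v \<and> dist u v \<le> isol u + isol v}"
  have step: "\<exists>q\<in>?V. True \<and> (\<forall>q'\<in>F. {fst q', snd q'} \<inter> {fst q, snd q} = {})"
    if F: "finite F" for F :: "('a \<times> 'a) set"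
  proof -
    have "finite (fst ` F \<union> snd ` F)" using F by simp
    then obtain u v where uv: "u \<notin> fst ` F \<union> snd ` F" "v \<notin> fst ` F \<union> snd ` F"
      "u \<noteq> v" "dist u v \<le> isol u + isol v" using True by (metis (no_types, lifting))
    then show ?thesis by (intro bexI[of _ "(u, v)"]) force+
  qed
  obtain q where q: "\<And>n::nat. q n \<in> ?V"
    "\<And>m n. m < n \<Longrightarrow> {fst (q m), snd (q m)} \<inter> {fst (q n), snd (q n)} = {}"
    using finite_extension_sequence[of ?V "\<lambda>_ _. True", OF step] by (smt (verit))
  have "\<exists>f. bump_family f (\<lambda>n. fst (q n)) (\<lambda>n. snd (q n))"
  proof (rule bump_family_pairs)
    fix m n :: nat assume "m \<noteq> n"
    then show "{fst (q m), snd (q m)} \<inter> {fst (q n), snd (q n)} = {}"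
      using q(2)[of m n] q(2)[of n m] by (metis Int_commute linorder_neqE_nat)
  qed (use q(1) in \<open>auto simp: case_prod_beta\<close>)
  then show ?thesis by blast
next
  case False
  then obtain G :: "'a set" where G: "finite G"
    "\<And>u v. u \<notin> G \<Longrightarrow> v \<notin> G \<Longrightarrow> u \<noteq> v \<Longrightarrow> isol u + isol v < dist u v"
    by (meson not_le)
  \<comment> \<open>Nearest points of points in \<open>B\<close> lie in \<open>G\<close>, and no two
    points of \<open>B\<close> share one; so \<open>B\<close> is finite.\<close>
  define B where "B = {u. u \<notin> G \<and> (\<exists>v. v \<noteq> u \<and> dist u v = isol u)}"
  define nb where "nb u = (SOME v. v \<noteq> u \<and> dist u v = isol u)" for u :: 'a
  have nb: "nb u \<noteq> u" "dist u (nb u) = isol u" if "u \<in> B" for u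
    using that someI_ex[of "\<lambda>v. v \<noteq> u \<and> dist u v = isol u"] unfolding B_def nb_def by auto
  have nbG: "nb u \<in> G" if "u \<in> B" for u
    using nb[OF that] G(2)[of u "nb u"] that isol_nonneg[of "nb u"] unfolding B_def by force
  have "inj_on nb B"
  proof
    fix u v assume uv: "u \<in> B" "v \<in> B" "nb u = nb v"
    have "dist u v \<le> isol u + isol v"
      using dist_triangle2[of u v "nb u"] nb(2)[OF uv(1)] nb(2)[OF uv(2)] uv(3)
      by (simp add: dist_commute)
    then show "u = v" using G(2)[of u v] uv unfolding B_def by force
  qed
  then have finB: "finite B"
    using G(1) nbG by (meson finite_subset finite_imageD image_subsetI)
  define S where "S = - (G \<union> B)"
  have finS: "finite (- S)" unfolding S_def using G(1) finB by simp
  have S_inf: "infinite S" using inf finS by (metis Compl_partition finite_UnI)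
  have S_isol: "isol u < dist u v" if "u \<in> S" "v \<noteq> u" for u v
    using that isol_le[of u v] unfolding S_def B_def by force
  have near: "infinite {w \<in> S. isol w < e}" if e: "e > 0" for e
  proof -
    obtain u where u: "u \<in> S" using infinite_imp_nonempty[OF S_inf] by blast
    have "infinite {v. v \<noteq> u \<and> dist u v < isol u + e}"
      by (rule infinite_near_if_isol_not_attained[OF inf _ e]) (use S_isol[OF u] in force)
    then have "infinite ({v. v \<noteq> u \<and> dist u v < isol u + e} - (- S))"
      using finS by (rule Diff_infinite_finite[rotated])
    \<comment> \<open>Off \<open>G\<close>, \<open>isol u + isol v < dist u v < isol u + e\<close>
      gives \<open>isol v < e\<close>.\<close>
    moreover have "{v. v \<noteq> u \<and> dist u v < isol u + e} - (- S) \<subseteq> {w \<in> S. isol w < e}"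
      using G(2)[of u] u unfolding S_def by force
    ultimately show ?thesis using finite_subset by blast
  qed
  have step: "\<exists>w\<in>S. isol w < 1 / real (Suc n) \<and> (\<forall>w'\<in>F. w' \<noteq> w)" if "finite F" for n F
  proof -
    have "infinite ({w \<in> S. isol w < 1 / real (Suc n)} - F)"
      using near[of "1 / real (Suc n)"] that by simp
    then obtain w where "w \<in> {w \<in> S. isol w < 1 / real (Suc n)} - F"
      using infinite_imp_nonempty by blast
    then show ?thesis by blast
  qed
  obtain w where w: "\<And>n::nat. w n \<in> S" "\<And>n. isol (w n) < 1 / real (Suc n)"
    "\<And>m n. m < n \<Longrightarrow> w m \<noteq> w n"
    using finite_extension_sequence[of S "\<lambda>n w. isol w < 1 / real (Suc n)" "(\<noteq>)", OF step]
    by blast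
  have "inj w" using w(3) by (rule linorder_injI)
  then have "infinite (range w)" by (rule range_inj_infinite)
  from separated_or_limit_point[OF this] show ?thesis
  proof (elim disjE exE conjE)
    fix e :: real
    assume e: "e > 0" and not_covered: "\<forall>F. finite F \<longrightarrow> \<not> range w \<subseteq> (\<Union>c\<in>F. ball c e)"
    have step: "\<exists>y\<in>{u. isol u < e / 2}. True \<and> (\<forall>x\<in>F. e \<le> dist x y)"
      if "finite F" for F :: "'a set"
    proof -
      obtain N where N: "1 / real (Suc N) < e / 2"
        using nat_approx_posE[of "e / 2"] e by auto
      \<comment> \<open>The first \<open>N\<close> points as extra centres force the uncovered index
        to be at least \<open>N\<close>, where \<open>isol\<close> is below
        \<open>e / 2\<close>.\<close>
      have "\<not> range w \<subseteq> (\<Union>c\<in>F \<union> w ` {..<N}. ball c e)"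
        using that by (intro not_covered[rule_format]) simp
      then obtain n where n: "w n \<notin> (\<Union>c\<in>F \<union> w ` {..<N}. ball c e)" by blast
      then have "\<not> n < N" using e by force
      then have "1 / real (Suc n) \<le> 1 / real (Suc N)" by (simp add: field_simps)
      then have "isol (w n) < e / 2" using w(2)[of n] N by linarith
      then show ?thesis using n by (auto intro!: bexI[of _ "w n"] simp: not_less)
    qed
    obtain x :: "nat \<Rightarrow> 'a" where "\<And>n. x n \<in> {u. isol u < e / 2}" "\<And>m n. m < n \<Longrightarrow> e \<le> dist (x m) (x n)"
      using finite_extension_sequence[of "{u. isol u < e / 2}" "\<lambda>_ _. True", OF step]
      by blast
    then have "\<exists>f y. bump_family f x y"
      by (intro bump_family_balls[OF inf, of _ "\<lambda>_. e / 2"]) auto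
    then show ?thesis by blast
  next
    fix z assume limit: "z islimpt range w"
    \<comment> \<open>The midpoint exceeds \<open>isol u\<close> and leaves room before
      \<open>z\<close> for the balls of later centres.\<close>
    define t where "t u = (isol u + dist u z) / 2" for u
    have t: "isol u < t u" "t u < dist u z" if "u \<in> S - {z}" for u
      using S_isol[of u z] that unfolding t_def by auto
    have step: "\<exists>y\<in>S - {z}. True \<and> (\<forall>x\<in>F. 2 * dist y z \<le> dist x z - t x)"
      if F: "finite F" "F \<subseteq> S - {z}" for F
    proof -
      \<comment> \<open>The 1 keeps the minimum defined when \<open>F\<close> is empty.\<close>
      define e where "e = Min (insert 1 ((\<lambda>x. (dist x z - t x) / 2) ` F))"
      have "e > 0" unfolding e_def using F t(2) by auto
      then obtain y where y: "y \<in> range w" "y \<noteq> z" "dist y z < e"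
        using limit unfolding islimpt_approachable by blast
      have "2 * dist y z \<le> dist x z - t x" if "x \<in> F" for x
      proof -
        have "e \<le> (dist x z - t x) / 2" unfolding e_def using F(1) that by (intro Min_le) auto
        then have "2 * e \<le> dist x z - t x" by (simp add: field_simps)
        with y(3) show ?thesis by simp
      qed
      then show ?thesis using y w(1) by blast
    qed
    obtain x where x: "\<And>n::nat. x n \<in> S - {z}"
      "\<And>m n. m < n \<Longrightarrow> 2 * dist (x n) z \<le> dist (x m) z - t (x m)"
      using finite_extension_sequence[of "S - {z}" "\<lambda>_ _. True", OF step] by blast
    have "\<exists>f y. bump_family f x y"
    proof (rule bump_family_balls[OF inf])
      show "isol (x n) < t (x n)" for n using t(1) x(1) .
      \<comment> \<open>One copy of \<open>dist (x n) z\<close> pays for \<open>t (x n)\<close>, the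
        other for the triangle inequality through \<open>z\<close>.\<close>
      show "t (x m) + t (x n) \<le> dist (x m) (x n)" if "m < n" for m n
        using x(2)[OF that] t(2)[OF x(1)[of n]] dist_triangle[of "x m" z "x n"]
        by linarith
    qed
    then show ?thesis by blast
  qed
qed

theorem mainTheorem1:
  fixes p :: "'a::complete_space"
  assumes "infinite (UNIV :: 'a set)"
  shows "\<exists>T. linear_operator c0 (Lip0 p) T \<and>
             isomorphism_onto_image c0 c0_norm Lip_norm T \<and>
             T ` c0 \<subseteq> SNA p"
proof -
  obtain f and x y :: "nat \<Rightarrow> 'a" where "bump_family f x y"
    using bump_family_exists[OF assms] by blast
  then show ?thesis by (rule bump_family.c0_embeds_in_SNA)
qed

end
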